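(* Let $V$ be a simple weight $\mathfrak{age}(1)$-module and let $\dot h\in\mathbb{C}$ be a weight of $V$, i.e. $V_{\dot h}\neq0$. Then either $\dim V_{\dot h+i}\le1$ for all $i\in\mathbb{Z}$, or $\dim V_{\dot h+i}=\infty$ for all $i\in\mathbb{Z}$.
   Context: The ageing algebra $\mathfrak{age}(1)$ is the complex Lie algebra with basis $\{e,h,p,q,z\}$, $z$ central, and brackets $[h,e]=2e$, $[e,q]=p$, $[e,p]=0$, $[h,p]=p$, $[h,q]=-q$, $[p,q]=z$. On every simple module $z$ acts as a scalar. A weight module is a module on which $h$ acts diagonalizably, and $V_{\mu}=\{v\in V: hv=\mu v\}$ denotes the weight space of weight $\mu\in\mathbb{C}$. *)

theory Defs
  imports Complex_Main "HOL-Library.Extended_Nat" "HOL-Library.Product_Plus"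
begin

section \<open>Lie algebras and their modules\<close>

locale lie_algebra = vector_space scale
  for scale :: "'k::field \<Rightarrow> 'g::ab_group_add \<Rightarrow> 'g" +
  fixes bracket :: "'g \<Rightarrow> 'g \<Rightarrow> 'g"
  assumes bracket_linear_left: "Vector_Spaces.linear scale scale (\<lambda>x. bracket x y)"
    and bracket_linear_right: "Vector_Spaces.linear scale scale (\<lambda>y. bracket x y)"
    and bracket_self: "bracket x x = 0"
    and jacobi:
      "bracket x (bracket y w) + bracket y (bracket w x) + bracket w (bracket x y) = 0"

locale lie_module = lie_algebra scale bracket + V: vector_space scaleV
  for scale :: "'k::field \<Rightarrow> 'g::ab_group_add \<Rightarrow> 'g"
    and bracket :: "'g \<Rightarrow> 'g \<Rightarrow> 'g"
    and scaleV :: "'k \<Rightarrow> 'v::ab_group_add \<Rightarrow> 'v" +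
  fixes act :: "'g \<Rightarrow> 'v \<Rightarrow> 'v"
  assumes act_linear_left: "Vector_Spaces.linear scale scaleV (\<lambda>x. act x v)"
    and act_linear_right: "Vector_Spaces.linear scaleV scaleV (\<lambda>v. act x v)"
    and act_bracket: "act (bracket x y) v = act x (act y v) - act y (act x v)"

definition lie_submodule ::
    "('k::field \<Rightarrow> 'v::ab_group_add \<Rightarrow> 'v) \<Rightarrow> ('g \<Rightarrow> 'v \<Rightarrow> 'v) \<Rightarrow> 'v set \<Rightarrow> bool" where
  "lie_submodule scaleV act W \<longleftrightarrow>
     module.subspace scaleV W \<and> (\<forall>x. \<forall>w\<in>W. act x w \<in> W)"

definition simple_lie_module ::
    "('k::field \<Rightarrow> 'v::ab_group_add \<Rightarrow> 'v) \<Rightarrow> ('g \<Rightarrow> 'v \<Rightarrow> 'v) \<Rightarrow> bool" where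
  "simple_lie_module scaleV act \<longleftrightarrow>
     (UNIV :: 'v set) \<noteq> {0} \<and>
     (\<forall>W. lie_submodule scaleV act W \<longrightarrow> W = {0} \<or> W = UNIV)"

section \<open>Eigenspaces and dimension\<close>

definition eigenspace ::
    "('k::field \<Rightarrow> 'v::ab_group_add \<Rightarrow> 'v) \<Rightarrow> ('v \<Rightarrow> 'v) \<Rightarrow> 'k \<Rightarrow> 'v set" where
  "eigenspace scaleV T \<mu> = {v. T v = scaleV \<mu> v}"

definition diagonalizable ::
    "('k::field \<Rightarrow> 'v::ab_group_add \<Rightarrow> 'v) \<Rightarrow> ('v \<Rightarrow> 'v) \<Rightarrow> bool" where
  "diagonalizable scaleV T \<longleftrightarrow>
     (\<exists>B. \<not> module.dependent scaleV B \<and> module.span scaleV B = UNIV \<and>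
          (\<forall>b\<in>B. \<exists>\<mu>. b \<in> eigenspace scaleV T \<mu>))"

text \<open>The library's \<^term>\<open>vector_space.dim\<close> is natural-valued and returns 0 on
  infinite-dimensional spaces; the following variant returns \<^term>\<open>\<infinity>\<close> there.\<close>

definition edim :: "('k::field \<Rightarrow> 'v::ab_group_add \<Rightarrow> 'v) \<Rightarrow> 'v set \<Rightarrow> enat" where
  "edim scaleV S =
     (if \<exists>B. finite B \<and> S \<subseteq> module.span scaleV B
      then enat (vector_space.dim scaleV S) else \<infinity>)"

section \<open>The ageing algebra\<close>

locale ageing_algebra = lie_algebra scale bracket
  for scale :: "complex \<Rightarrow> 'g::ab_group_add \<Rightarrow> 'g"
    and bracket :: "'g \<Rightarrow> 'g \<Rightarrow> 'g" +
  fixes e h p q z :: 'g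
  assumes basis_distinct: "distinct [e, h, p, q, z]"
    and basis_independent: "independent {e, h, p, q, z}"
    and basis_span: "span {e, h, p, q, z} = UNIV"
    and z_central: "bracket z x = 0"
    and bracket_h_e: "bracket h e = scale 2 e"
    and bracket_e_q: "bracket e q = p"
    and bracket_e_p: "bracket e p = 0"
    and bracket_h_p: "bracket h p = p"
    and bracket_h_q: "bracket h q = - q"
    and bracket_p_q: "bracket p q = z"

locale ageing_module =
  ageing_algebra scale bracket e h p q z + lie_module scale bracket scaleV act
  for scale :: "complex \<Rightarrow> 'g::ab_group_add \<Rightarrow> 'g"
    and bracket :: "'g \<Rightarrow> 'g \<Rightarrow> 'g"
    and e h p q z :: 'g
    and scaleV :: "complex \<Rightarrow> 'v::ab_group_add \<Rightarrow> 'v"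
    and act :: "'g \<Rightarrow> 'v \<Rightarrow> 'v"

text \<open>The axioms of \<open>ageing_algebra\<close> determine the algebra up to isomorphism; they are
  consistent, as the realisation below on coordinates with respect to
  \<open>e, h, p, q, z\<close> shows.\<close>

type_synonym coords = "complex \<times> complex \<times> complex \<times> complex \<times> complex"

definition coords_scale :: "complex \<Rightarrow> coords \<Rightarrow> coords" where
  "coords_scale c = (\<lambda>(x1, x2, x3, x4, x5). (c * x1, c * x2, c * x3, c * x4, c * x5))"

definition coords_bracket :: "coords \<Rightarrow> coords \<Rightarrow> coords" where
  "coords_bracket = (\<lambda>(x1, x2, x3, x4, x5) (y1, y2, y3, y4, y5).
     (2 * (x2 * y1 - x1 * y2),
      0,
      (x1 * y4 - x4 * y1) + (x2 * y3 - x3 * y2),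
      - (x2 * y4 - x4 * y2),
      x3 * y4 - x4 * y3))"

lemma ageing_algebra_exists:
  "ageing_algebra coords_scale coords_bracket
     (1, 0, 0, 0, 0) (0, 1, 0, 0, 0) (0, 0, 1, 0, 0) (0, 0, 0, 1, 0) (0, 0, 0, 0, 1)"
proof -
  interpret vector_space coords_scale
    by unfold_locales (auto simp: coords_scale_def algebra_simps)
  interpret lie_algebra coords_scale coords_bracket
    by unfold_locales
      (auto simp: coords_scale_def coords_bracket_def zero_prod_def algebra_simps)
  let ?B = "{(1, 0, 0, 0, 0), (0, 1, 0, 0, 0), (0, 0, 1, 0, 0), (0, 0, 0, 1, 0),
    (0, 0, 0, 0, 1)} :: coords set"
  have "independent ?B"
    by (rule independent_if_scalars_zero)
      (auto simp: coords_scale_def zero_prod_def)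
  moreover have "x \<in> span ?B" for x
  proof -
    obtain a b c d f where x: "x = (a, b, c, d, f)" by (cases x) auto
    have "coords_scale a (1, 0, 0, 0, 0) + coords_scale b (0, 1, 0, 0, 0) +
      coords_scale c (0, 0, 1, 0, 0) + coords_scale d (0, 0, 0, 1, 0) +
      coords_scale f (0, 0, 0, 0, 1) \<in> span ?B"
      by (intro span_add span_scale span_base) auto
    then show ?thesis by (simp add: x coords_scale_def)
  qed
  ultimately show ?thesis
    by unfold_locales
      (auto simp: coords_scale_def coords_bracket_def zero_prod_def split: prod.splits)
qed

end

theory Submission
  imports Defs "HOL-Computational_Algebra.Fundamental_Theorem_Algebra"
begin

text \<open>The operators of weight zero are generated, up to \<open>h\<close>, by \<open>z\<close>, \<open>X = pq\<close> and
  \<open>Y = eq\<^sup>2\<close>, and every weight space is zero or simple over them. If \<open>z\<close> acts by \<open>c\<close>, then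
  \<open>[Y, X] = X\<^sup>2\<close> for \<open>c = 0\<close>, while \<open>[X, w] = 2cw\<close> for \<open>c \<noteq> 0\<close> with a certain \<open>w\<close> that can
  replace \<open>Y\<close>. On a nonzero finite-dimensional weight space such a relation prevents \<open>X\<close>,
  respectively \<open>w\<close>, from being injective; its kernel is stable, so it acts by zero there, and a
  simple module over one remaining operator is a line.

  Finiteness spreads from the weight \<open>\<nu>\<close> to \<open>\<nu> + 1\<close> and \<open>\<nu> - 1\<close>: an infinite-dimensional
  neighbour would contain a nonzero stable subspace on which too few operators act
  nontrivially (the kernel of \<open>q\<close> or of \<open>p\<close>), or a finite-dimensional stable subspace
  absorbing \<open>qp\<close> and \<open>w\<close>.\<close>

lemma funpow_commute:
  assumes "\<And>u. A (B u) = B (A u)"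
  shows "A ((B ^^ n) v) = (B ^^ n) (A v)"
  by (induction n) (auto simp: assms)

section \<open>Endomorphisms of complex vector spaces\<close>

locale complex_space = vector_space scale
  for scale :: "complex \<Rightarrow> 'v::ab_group_add \<Rightarrow> 'v"
begin

abbreviation endo :: "('v \<Rightarrow> 'v) \<Rightarrow> bool" where
  "endo \<equiv> Vector_Spaces.linear scale scale"

lemma endoD:
  assumes "endo A"
  shows "A (u + v) = A u + A v" "A (scale c v) = scale c (A v)" "A 0 = 0"
    "A (- v) = - A v" "A (u - v) = A u - A v"
proof -
  interpret A: Vector_Spaces.linear scale scale A by fact
  show "A (u + v) = A u + A v" "A (scale c v) = scale c (A v)" "A 0 = 0"
    "A (- v) = - A v" "A (u - v) = A u - A v"
    by (simp_all add: A.add A.scale A.neg A.diff)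
qed

lemma endoI:
  assumes "\<And>u v. A (u + v) = A u + A v" "\<And>c v. A (scale c v) = scale c (A v)"
  shows "endo A"
  by unfold_locales (auto simp: assms)

lemma endo_pow:
  assumes "endo A"
  shows "endo (A ^^ n)"
proof (induction n)
  case 0
  show ?case by (rule endoI) auto
next
  case (Suc n)
  show ?case by (rule endoI) (auto simp: endoD[OF assms] endoD[OF Suc])
qed

lemma double_cancel:
  fixes u v :: 'v
  assumes "u + u = v + v"
  shows "u = v"
proof -
  have "scale 2 x = x + x" for x using scale_left_distrib[of 1 1 x] by simp
  then have "scale 2 u = scale 2 v" using assms by simp
  then show ?thesis by simp
qed

section \<open>Polynomials in an endomorphism, evaluated at a vector by Horner's scheme\<close>

definition peval :: "('v \<Rightarrow> 'v) \<Rightarrow> complex poly \<Rightarrow> 'v \<Rightarrow> 'v" where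
  "peval A g v = fold_coeffs (\<lambda>a u. scale a v + A u) g 0"

lemma peval_0 [simp]: "peval A 0 v = 0"
  by (simp add: peval_def)

lemma peval_pCons:
  assumes "endo A"
  shows "peval A (pCons a g) v = scale a v + A (peval A g v)"
  by (cases "g = 0 \<and> a = 0") (auto simp: peval_def endoD[OF assms])

lemma endo_peval:
  assumes "endo A"
  shows "endo (peval A g)"
proof (induction g)
  case 0
  show ?case by (rule endoI) auto
next
  case (pCons a g)
  show ?case
    by (rule endoI)
      (auto simp: peval_pCons assms endoD[OF assms] endoD[OF pCons.IH] algebra_simps)
qed

lemma peval_add:
  assumes "endo A"
  shows "peval A (f + g) v = peval A f v + peval A g v"
proof (induction f g rule: poly_induct2)
  case (pCons a f b g)
  then show ?case
    by (simp add: peval_pCons assms endoD[OF assms] algebra_simps)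
qed simp

lemma peval_smult:
  assumes "endo A"
  shows "peval A (smult c g) v = scale c (peval A g v)"
  by (induction g) (auto simp: peval_pCons assms endoD[OF assms] algebra_simps)

lemma peval_mult:
  assumes "endo A"
  shows "peval A (f * g) v = peval A f (peval A g v)"
  by (induction f) (auto simp: peval_pCons peval_add peval_smult assms)

lemma peval_sum:
  assumes "endo A"
  shows "peval A (\<Sum>i\<in>I. f i) v = (\<Sum>i\<in>I. peval A (f i) v)"
  by (induction I rule: infinite_finite_induct) (auto simp: peval_add assms)

lemma peval_monom:
  assumes "endo A"
  shows "peval A (monom c n) v = scale c ((A ^^ n) v)"
  by (induction n) (auto simp: monom_0 monom_Suc peval_pCons endoD[OF assms] assms)

lemma peval_eigenvector:
  assumes "endo A" "A v = scale r v"
  shows "peval A g v = scale (poly g r) v"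
  by (induction g)
    (auto simp: peval_pCons assms(1) assms(2) endoD[OF assms(1)] algebra_simps)

lemma peval_in_subspace:
  assumes "endo A" "subspace U" "\<And>u. u \<in> U \<Longrightarrow> A u \<in> U" "v \<in> U"
  shows "peval A g v \<in> U"
  by (induction g) (auto simp: peval_pCons assms subspace_0 subspace_add subspace_scale)

section \<open>Eigenvectors and invariant lines\<close>

lemma subspace_kernel:
  assumes "endo A"
  shows "subspace {v. A v = 0}"
  by (auto simp: subspace_def endoD[OF assms])

lemma subspace_eigenspace:
  assumes "endo A"
  shows "subspace (eigenspace scale A r)"
  by (auto simp: subspace_def eigenspace_def endoD[OF assms] algebra_simps)

text \<open>Split off a complex root \<open>r\<close> of \<open>g\<close>, leaving a cofactor
  \<open>f\<close>. Either \<open>f\<close> also annihilates \<open>v\<close> and has smaller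
  degree, or \<open>A - r\<close> kills the nonzero vector \<open>peval A f v\<close>.\<close>

lemma eigenvector_of_annihilator:
  assumes A: "endo A" and "v \<noteq> 0" "g \<noteq> 0" "peval A g v = 0"
  shows "\<exists>f r. peval A f v \<noteq> 0 \<and> A (peval A f v) = scale r (peval A f v)"
  using assms(3,4)
proof (induction "degree g" arbitrary: g rule: less_induct)
  case less
  show ?case
  proof (cases "degree g = 0")
    case True
    then obtain a where "g = [:a:]" by (rule degree_eq_zeroE)
    with less.prems \<open>v \<noteq> 0\<close> show ?thesis
      by (simp add: peval_pCons[OF A] endoD[OF A])
  next
    case False
    then obtain r where "poly g r = 0"
      using fundamental_theorem_of_algebra_alt[of g]
      by (metis degree_pCons_0)
    then obtain f where f: "g = [:-r, 1:] * f"
      by (auto simp: poly_eq_0_iff_dvd)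
    with less.prems have "f \<noteq> 0" by auto
    then have deg: "degree f < degree g"
      by (simp add: f degree_mult_eq del: mult_pCons_left)
    show ?thesis
    proof (cases "peval A f v = 0")
      case True
      with less.hyps deg \<open>f \<noteq> 0\<close> show ?thesis by blast
    next
      case False
      have "A (peval A f v) = scale r (peval A f v)"
        using less.prems(2)
        by (simp add: f peval_mult[OF A] peval_pCons[OF A] endoD[OF A]
            del: mult_pCons_left)
      with False show ?thesis by blast
    qed
  qed
qed

text \<open>An eigenvector spans an invariant line, which must be all of \<open>U\<close>. To find
  one without finiteness of \<open>U\<close>, take \<open>A v\<close> nonzero: its images under
  polynomials in \<open>A\<close> form a nonzero invariant subspace, hence contain \<open>v\<close>.
  So \<open>v = g(A) A v\<close>, and the nonzero polynomial \<open>1 - x g(x)\<close> annihilates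
  \<open>v\<close>.\<close>

lemma invariant_irreducible_imp_line:
  assumes A: "endo A" and U: "subspace U" and AU: "\<And>u. u \<in> U \<Longrightarrow> A u \<in> U"
    and irr: "\<And>S. subspace S \<Longrightarrow> S \<subseteq> U \<Longrightarrow> (\<And>s. s \<in> S \<Longrightarrow> A s \<in> S) \<Longrightarrow> S = {0} \<or> S = U"
  shows "\<exists>v. U \<subseteq> span {v}"
proof (cases "U = {0}")
  case True
  then show ?thesis using span_zero by blast
next
  case False
  then obtain v where v: "v \<in> U" "v \<noteq> 0"
    using subspace_0[OF U] by blast
  have line: ?thesis if "u \<in> U" "u \<noteq> 0" "A u = scale r u" for u r
  proof -
    have "A s \<in> span {u}" if "s \<in> span {u}" for s
      using that \<open>A u = scale r u\<close>
      by (auto simp: span_singleton endoD[OF A])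
    moreover have "span {u} \<subseteq> U"
      using span_minimal[OF _ U] \<open>u \<in> U\<close> by blast
    ultimately have "span {u} = {0} \<or> span {u} = U"
      by (intro irr) auto
    with \<open>u \<noteq> 0\<close> show ?thesis by (metis order_refl singletonD singletonI span_base)
  qed
  show ?thesis
  proof (cases "A v = 0")
    case True
    with v line[of v 0] show ?thesis by simp
  next
    case False
    let ?S = "range (\<lambda>g. peval A g (A v))"
    have "subspace ?S"
      unfolding subspace_def
    proof (intro conjI ballI allI)
      show "0 \<in> ?S" by (rule range_eqI[of _ _ 0]) simp
      show "x + y \<in> ?S" if "x \<in> ?S" "y \<in> ?S" for x y
        using that by (auto simp flip: peval_add[OF A])
      show "scale c x \<in> ?S" if "x \<in> ?S" for c x
        using that by (auto simp flip: peval_smult[OF A])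
    qed
    moreover have "?S \<subseteq> U"
      using peval_in_subspace[OF A U AU] AU v(1) by auto
    moreover have "A s \<in> ?S" if s: "s \<in> ?S" for s
    proof -
      obtain g where "s = peval A g (A v)" using s by auto
      then have "A s = peval A (pCons 0 g) (A v)"
        by (simp add: peval_pCons[OF A])
      then show ?thesis by blast
    qed
    ultimately have "?S = {0} \<or> ?S = U" by (intro irr)
    moreover have "A v \<in> ?S"
      by (rule range_eqI[of _ _ 1])
        (simp add: one_pCons peval_pCons[OF A] endoD[OF A])
    ultimately have "v \<in> ?S" using False v by auto
    then obtain g where g: "v = peval A g (A v)" by auto
    have "A (peval A f u) = peval A f (A u)" for f u
      by (induction f) (auto simp: peval_pCons[OF A] endoD[OF A])
    then have "peval A (pCons 1 (- g)) v = 0"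
      using g peval_smult[OF A, of "-1" g v]
      by (simp add: peval_pCons[OF A] endoD[OF A])
    then obtain f r where "peval A f v \<noteq> 0" "A (peval A f v) = scale r (peval A f v)"
      using eigenvector_of_annihilator[OF A v(2), of "pCons 1 (- g)"] by auto
    then show ?thesis
      using line peval_in_subspace[OF A U AU v(1)] by blast
  qed
qed

section \<open>Finite-dimensional subspaces and annihilating polynomials\<close>

definition fin_dim :: "'v set \<Rightarrow> bool" where
  "fin_dim U \<longleftrightarrow> (\<exists>B. finite B \<and> U \<subseteq> span B)"

lemma fin_dim_basis:
  assumes "fin_dim U"
  obtains B where "finite B" "B \<subseteq> U" "U \<subseteq> span B"
proof -
  obtain C where C: "finite C" "U \<subseteq> span C" using assms by (auto simp: fin_dim_def)
  obtain B where B: "B \<subseteq> U" "independent B" "U \<subseteq> span B"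
    using basis_exists[of U] by metis
  have "finite B" using independent_span_bound[OF C(1) B(2)] B C by auto
  with B that show ?thesis by blast
qed

lemma fin_dim_inj:
  assumes f: "endo f" and U: "subspace U" and inj: "\<And>u. u \<in> U \<Longrightarrow> f u = 0 \<Longrightarrow> u = 0"
    and "f ` U \<subseteq> T" "fin_dim T"
  shows "fin_dim U"
proof -
  interpret f: Vector_Spaces.linear scale scale f by fact
  obtain C where C: "finite C" "T \<subseteq> span C" using assms by (auto simp: fin_dim_def)
  obtain B where B: "B \<subseteq> U" "independent B" "U \<subseteq> span B"
    using basis_exists[of U] by metis
  have sB: "span B \<subseteq> U" using span_minimal[OF B(1) U] .
  have injB: "inj_on f (span B)"
  proof (rule inj_onI)
    fix x y assume "x \<in> span B" "y \<in> span B" "f x = f y"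
    then have "x - y \<in> U" "f (x - y) = 0"
      using sB span_diff by (auto simp: f.diff)
    then show "x = y" using inj by force
  qed
  have "independent (f ` B)"
    using f.independent_inj_on_image[OF B(2) injB] .
  then have "finite (f ` B)"
    using independent_span_bound[OF C(1)] B(1) C(2) assms(4) by blast
  moreover have "inj_on f B" using injB span_superset inj_on_subset by blast
  ultimately have "finite B" using finite_imageD by blast
  with B show ?thesis by (auto simp: fin_dim_def)
qed

lemma fin_dim_image:
  assumes A: "endo A" and "fin_dim U"
  shows "fin_dim (A ` U)"
proof -
  obtain B where B: "finite B" "U \<subseteq> span B" using assms(2) by (auto simp: fin_dim_def)
  have "A ` U \<subseteq> span (A ` B)"
    using module_hom.span_image[of scale scale A B] A B(2)
    by (auto simp: module_hom_iff_linear)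
  with B(1) show ?thesis unfolding fin_dim_def by blast
qed

lemma fin_dim_sums:
  assumes "fin_dim U" "fin_dim T"
  shows "fin_dim {x + y | x y. x \<in> U \<and> y \<in> T}"
proof -
  obtain B C where BC: "finite B" "U \<subseteq> span B" "finite C" "T \<subseteq> span C"
    using assms by (auto simp: fin_dim_def)
  have "x + y \<in> span (B \<union> C)" if "x \<in> U" "y \<in> T" for x y
    using that BC span_mono[of B "B \<union> C"] span_mono[of C "B \<union> C"] by (intro span_add) auto
  with BC(1,3) show ?thesis unfolding fin_dim_def by blast
qed

lemma endo_image_subspace:
  assumes "endo A" "subspace U"
  shows "subspace (A ` U)"
  using assms module_hom.subspace_image[of scale scale A U] by (simp add: module_hom_iff_linear)

text \<open>The first \<open>card B + 1\<close> iterates of \<open>v\<close> lie in the span of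
  \<open>B\<close>, so they satisfy a linear relation, whose coefficients form the
  polynomial.\<close>

lemma local_annihilator:
  assumes A: "endo A" and "fin_dim U" and AU: "\<And>u. u \<in> U \<Longrightarrow> A u \<in> U" and "v \<in> U"
  shows "\<exists>g. g \<noteq> 0 \<and> peval A g v = 0"
proof -
  obtain B where B: "finite B" "U \<subseteq> span B" using assms by (auto simp: fin_dim_def)
  define a where "a n = (A ^^ n) v" for n
  have aU: "a n \<in> U" for n by (induction n) (auto simp: a_def AU \<open>v \<in> U\<close>)
  let ?I = "{..card B}"
  show ?thesis
  \<comment> \<open>Linear dependence is a property of sets and does not see repetitions. If two
    iterates coincide, the difference of two monomials serves instead.\<close>
  proof (cases "inj_on a ?I")
    case False
    then obtain i j where ij: "i \<noteq> j" "a i = a j" by (auto simp: inj_on_def)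
    have "peval A (monom 1 i + monom (- 1) j) v = 0"
      using ij by (simp add: peval_add[OF A] peval_monom[OF A] a_def)
    moreover have "coeff (monom 1 i + monom (- 1 :: complex) j) i \<noteq> 0"
      using ij by simp
    then have "monom 1 i + monom (- 1 :: complex) j \<noteq> 0" by (metis coeff_0)
    ultimately show ?thesis by blast
  next
    case True
    then have "card (a ` ?I) = Suc (card B)" by (simp add: card_image)
    then have "dependent (a ` ?I)"
      using independent_span_bound[OF B(1), of "a ` ?I"] aU B(2) by fastforce
    then obtain u w where u: "w \<in> a ` ?I" "u w \<noteq> 0" "(\<Sum>w\<in>a ` ?I. scale (u w) w) = 0"
      by (auto simp: dependent_finite)
    then obtain k where k: "k \<in> ?I" "w = a k" by auto
    let ?g = "\<Sum>i\<in>?I. monom (u (a i)) i"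
    have "peval A ?g v = 0"
      using u(3) by (simp add: peval_sum[OF A] peval_monom[OF A] sum.reindex[OF True] flip: a_def)
    moreover have "coeff ?g k = u (a k)"
      using k by (simp add: coeff_sum)
    then have "?g \<noteq> 0" using u k by (metis coeff_0)
    ultimately show ?thesis by blast
  qed
qed

text \<open>Take the product of local annihilators over a finite spanning set: polynomials in
  \<open>A\<close> commute, so each factor can be moved next to the vector that it kills.\<close>

lemma annihilator:
  assumes A: "endo A" and "fin_dim U" and AU: "\<And>u. u \<in> U \<Longrightarrow> A u \<in> U"
  shows "\<exists>g. g \<noteq> 0 \<and> (\<forall>u\<in>U. peval A g u = 0)"
proof -
  obtain B where B: "finite B" "B \<subseteq> U" "U \<subseteq> span B" using fin_dim_basis assms(2) .
  obtain a where a: "\<And>b. b \<in> B \<Longrightarrow> a b \<noteq> 0 \<and> peval A (a b) b = 0"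
    using local_annihilator[OF A assms(2) AU] B(2) by (metis subsetD)
  define g where "g = (\<Prod>b\<in>B. a b)"
  have "peval A g b = 0" if "b \<in> B" for b
  proof -
    have "g = (\<Prod>b\<in>B - {b}. a b) * a b"
      using that B(1) by (simp add: g_def prod.remove mult.commute)
    then show ?thesis
      using a[OF that] by (simp add: peval_mult[OF A] endoD[OF endo_peval[OF A]])
  qed
  then have "span B \<subseteq> {u. peval A g u = 0}"
    by (intro span_minimal subspace_kernel endo_peval A) auto
  moreover have "g \<noteq> 0" using a B(1) by (simp add: g_def)
  ultimately show ?thesis using B(3) by blast
qed

lemma fin_dim_eigenvector:
  assumes A: "endo A" and U: "subspace U" "fin_dim U" "U \<noteq> {0}"
    and AU: "\<And>u. u \<in> U \<Longrightarrow> A u \<in> U"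
  obtains u r where "u \<in> U" "u \<noteq> 0" "A u = scale r u"
proof -
  obtain v where v: "v \<in> U" "v \<noteq> 0" using U subspace_0 by blast
  obtain g where "g \<noteq> 0" "peval A g v = 0"
    using local_annihilator[OF A U(2) AU v(1)] by blast
  then show ?thesis
    using eigenvector_of_annihilator[OF A v(2)] peval_in_subspace[OF A U(1) AU v(1)] that
    by blast
qed

text \<open>The commutator with \<open>D\<close> differentiates polynomials in \<open>A\<close>, so it would turn a minimal
  polynomial of an injective \<open>A\<close> into an annihilating polynomial of smaller degree.\<close>

lemma commutator_not_injective:
  assumes A: "endo A" and D: "endo D" and M: "endo M"
    and U: "fin_dim U" "U \<noteq> {0}" "subspace U"
    and AU: "\<And>u. u \<in> U \<Longrightarrow> A u \<in> U"
    and DU: "\<And>u. u \<in> U \<Longrightarrow> D u \<in> U"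
    and MU: "\<And>u. u \<in> U \<Longrightarrow> M u \<in> U"
    and AM: "\<And>u. u \<in> U \<Longrightarrow> A (M u) = M (A u)"
    and DA: "\<And>u. u \<in> U \<Longrightarrow> D (A u) = A (D u) + A (M u)"
    and injA: "\<And>u. u \<in> U \<Longrightarrow> A u = 0 \<Longrightarrow> u = 0"
    and injM: "\<And>u. u \<in> U \<Longrightarrow> M u = 0 \<Longrightarrow> u = 0"
  shows False
proof -
  have PU: "peval A g u \<in> U" if "u \<in> U" for g u
    using peval_in_subspace[OF A U(3) AU that] .
  \<comment> \<open>On \<open>U\<close>, \<open>[D, A] = A M\<close> with \<open>M\<close> commuting
    with \<open>A\<close>, so the commutator of \<open>D\<close> with \<open>g(A)\<close> is
    \<open>A M g'(A)\<close>.\<close>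
  have deriv: "D (peval A g u) = peval A g (D u) + A (M (peval A (pderiv g) u))"
    if "u \<in> U" for g u
  proof (induction g)
    case 0
    then show ?case by (simp add: endoD[OF D] endoD[OF A] endoD[OF M])
  next
    case (pCons a g)
    then show ?case
      using DA[OF PU[OF that]] AM[OF PU[OF that]] that
      by (simp add: peval_pCons[OF A] pderiv_pCons peval_add[OF A] endoD[OF D] endoD[OF A]
          endoD[OF M] algebra_simps)
  qed
  \<comment> \<open>Descent on the degree: \<open>g'\<close> annihilates \<open>U\<close> as well,
    so it vanishes by induction, and in characteristic zero \<open>g\<close> is then a constant. A
    nonzero vector of \<open>U\<close> forces this constant to be zero.\<close>
  have "g = 0" if "\<forall>u\<in>U. peval A g u = 0" for g
    using that
  proof (induction "degree g" arbitrary: g rule: less_induct)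
    case less
    have pd: "\<forall>u\<in>U. peval A (pderiv g) u = 0"
    proof
      fix u assume u: "u \<in> U"
      then have "A (M (peval A (pderiv g) u)) = 0"
        using deriv[OF u, of g] less.prems DU by (simp add: endoD[OF D])
      then show "peval A (pderiv g) u = 0" using injA injM MU PU u by blast
    qed
    have "degree g = 0"
    proof (rule ccontr)
      assume "degree g \<noteq> 0"
      then have "pderiv g = 0"
        using less.hyps[OF _ pd] by (simp add: degree_pderiv)
      with \<open>degree g \<noteq> 0\<close> show False by (simp add: pderiv_eq_0_iff)
    qed
    then obtain a where "g = [:a:]" by (rule degree_eq_zeroE)
    moreover obtain u where "u \<in> U" "u \<noteq> 0" using U subspace_0 by blast
    ultimately show ?case
      using less.prems by (auto simp: peval_pCons[OF A] endoD[OF A])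
  qed
  with annihilator[OF A U(1) AU] show False by blast
qed

text \<open>A product of factors \<open>A - s\<close> with \<open>s \<noteq> r\<close> annihilates
  \<open>x\<close> as a sum of vectors from the other eigenspaces, yet it multiplies the eigenvector
  \<open>x\<close> by a nonzero scalar.\<close>

lemma eigenspace_inter_span_others:
  assumes A: "endo A" and x: "x \<in> eigenspace scale A r"
    and "x \<in> span (\<Union>s\<in>- {r}. eigenspace scale A s)"
  shows "x = 0"
proof -
  have "\<exists>g. poly g r \<noteq> 0 \<and> peval A g x = 0"
    using assms(3)
  proof (induction rule: span_induct_alt)
    case base
    show ?case by (rule exI[of _ 1]) (simp add: endoD[OF endo_peval[OF A]])
  next
    case (step c y w)
    then obtain s g where s: "s \<noteq> r" "A y = scale s y" and g: "poly g r \<noteq> 0" "peval A g w = 0"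
      by (auto simp: eigenspace_def)
    \<comment> \<open>The factors are ordered differently in the two summands, so that
      \<open>A - s\<close> meets \<open>y\<close> first and \<open>g(A)\<close> meets
      \<open>w\<close> first.\<close>
    have "peval A ([:-s, 1:] * g) (scale c y + w) = peval A (g * [:-s, 1:]) (scale c y)
      + peval A ([:-s, 1:] * g) w"
      by (simp only: endoD[OF endo_peval[OF A]] mult.commute)
    also have "\<dots> = 0"
      unfolding peval_mult[OF A] g(2)
      by (simp add: peval_pCons[OF A] endoD[OF A] endoD[OF endo_peval[OF A]] s)
    finally show ?case
      using g(1) s(1) by (intro exI[of _ "[:-s, 1:] * g"]) simp
  qed
  then obtain g where g: "poly g r \<noteq> 0" "peval A g x = 0" by blast
  from x have "peval A g x = scale (poly g r) x"
    using peval_eigenvector[OF A] by (simp add: eigenspace_def)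
  with g show ?thesis by simp
qed

end

section \<open>Weight spaces of simple modules\<close>

text \<open>The module seen through the action of the five basis elements. As rewrite rules the
  relations bring every product into the order \<open>q\<close>, \<open>p\<close>, \<open>e\<close>,
  \<open>h\<close>, \<open>z\<close>, so that identities between operators can be checked by
  simplification.\<close>

locale simple_ageing_operators = complex_space scale
  for scale :: "complex \<Rightarrow> 'v::ab_group_add \<Rightarrow> 'v" +
  fixes e h p q z :: "'v \<Rightarrow> 'v"
  assumes endos: "endo e" "endo h" "endo p" "endo q" "endo z"
    and e_q: "e (q v) = q (e v) + p v"
    and e_p: "e (p v) = p (e v)"
    and p_q: "p (q v) = q (p v) + z v"
    and h_e: "h (e v) = e (h v) + scale 2 (e v)"
    and h_p: "h (p v) = p (h v) + p v"
    and h_q: "h (q v) = q (h v) - q v"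
    and z_comm: "z (e v) = e (z v)" "z (h v) = h (z v)" "z (p v) = p (z v)" "z (q v) = q (z v)"
    and irreducible: "subspace W \<Longrightarrow>
      (\<And>w. w \<in> W \<Longrightarrow> e w \<in> W \<and> h w \<in> W \<and> p w \<in> W \<and> q w \<in> W \<and> z w \<in> W) \<Longrightarrow>
      W = {0} \<or> W = UNIV"
begin

lemmas lin = endos[THEN endoD(1)] endos[THEN endoD(2)] endos[THEN endoD(3)]
  endos[THEN endoD(4)] endos[THEN endoD(5)]

section \<open>Weight spaces and the shifts of weight\<close>

abbreviation wt :: "complex \<Rightarrow> 'v set" where
  "wt \<nu> \<equiv> eigenspace scale h \<nu>"

lemma subspace_wt: "subspace (wt \<nu>)"
  by (rule subspace_eigenspace[OF endos(2)])

lemma wt_shift: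
  assumes "v \<in> wt \<nu>"
  shows "e v \<in> wt (\<nu> + 2)" "p v \<in> wt (\<nu> + 1)" "q v \<in> wt (\<nu> - 1)" "z v \<in> wt \<nu>"
  using assms
  by (auto simp: eigenspace_def h_e h_p h_q lin scale_left_distrib scale_left_diff_distrib
      simp flip: z_comm)

lemma wt_pow:
  assumes "v \<in> wt \<nu>"
  shows "(e ^^ n) v \<in> wt (\<nu> + 2 * of_nat n)" "(p ^^ n) v \<in> wt (\<nu> + of_nat n)"
    "(q ^^ n) v \<in> wt (\<nu> - of_nat n)"
proof (induction n)
  case 0
  { case 1 show ?case using assms by simp }
  { case 2 show ?case using assms by simp }
  { case 3 show ?case using assms by simp }
next
  case (Suc n)
  { case 1 show ?case using wt_shift(1)[OF Suc(1)] by (simp add: algebra_simps) }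
  { case 2 show ?case using wt_shift(2)[OF Suc(2)] by (simp add: algebra_simps) }
  { case 3 show ?case using wt_shift(3)[OF Suc(3)] by (simp add: algebra_simps) }
qed

lemmas pow_lin = endo_pow[OF endos(1), THEN endoD(1)] endo_pow[OF endos(1), THEN endoD(2)]
  endo_pow[OF endos(3), THEN endoD(1)] endo_pow[OF endos(3), THEN endoD(2)]
  endo_pow[OF endos(4), THEN endoD(1)] endo_pow[OF endos(4), THEN endoD(2)]

section \<open>Operators of weight zero and commutation with powers\<close>

definition X :: "'v \<Rightarrow> 'v" where "X v = p (q v)"

definition Y :: "'v \<Rightarrow> 'v" where "Y v = e (q (q v))"

lemma wt_XY:
  assumes "v \<in> wt \<nu>"
  shows "X v \<in> wt \<nu>" "Y v \<in> wt \<nu>"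
  using wt_shift(2)[OF wt_shift(3)[OF assms]]
    wt_shift(1)[OF wt_shift(3)[OF wt_shift(3)[OF assms]]]
  by (simp_all add: X_def Y_def)

text \<open>Each of the \<open>i\<close> swaps contributes \<open>[q, e] = -p\<close>, which
  commutes with \<open>e\<close>. The truncated exponent \<open>i - 1\<close> is harmless, since its
  coefficient vanishes at \<open>i = 0\<close>.\<close>

lemma q_e_pow: "q ((e ^^ i) v) = (e ^^ i) (q v) - scale (of_nat i) ((e ^^ (i - 1)) (p v))"
proof (induction i)
  case (Suc i)
  have 1: "q ((e ^^ Suc i) v) = e (q ((e ^^ i) v)) - p ((e ^^ i) v)" by (simp add: e_q)
  have 2: "p ((e ^^ i) v) = (e ^^ i) (p v)"
    by (intro funpow_commute e_p[symmetric])
  have 3: "scale (of_nat i) (e ((e ^^ (i - 1)) (p v))) = scale (of_nat i) ((e ^^ i) (p v))"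
    by (cases i) auto
  show ?case by (simp only: 1 2 3 Suc lin) (simp add: algebra_simps)
qed simp

lemma q_p_pow: "q ((p ^^ j) v) = (p ^^ j) (q v) - scale (of_nat j) ((p ^^ (j - 1)) (z v))"
proof (induction j)
  case (Suc j)
  have 1: "q ((p ^^ Suc j) v) = p (q ((p ^^ j) v)) - z ((p ^^ j) v)" by (simp add: p_q)
  have 2: "z ((p ^^ j) v) = (p ^^ j) (z v)"
    by (intro funpow_commute z_comm)
  have 3: "scale (of_nat j) (p ((p ^^ (j - 1)) (z v))) = scale (of_nat j) ((p ^^ j) (z v))"
    by (cases j) auto
  show ?case by (simp only: 1 2 3 Suc lin) (simp add: algebra_simps)
qed simp

text \<open>Moving \<open>p\<close> past \<open>n\<close> of the factors \<open>q\<close> yields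
  \<open>n\<close> copies of the central \<open>z\<close>; the last \<open>q\<close> pairs with
  \<open>p\<close> to form \<open>X\<close>. Thus \<open>p\<close> is absorbed by an operator of
  weight zero.\<close>

lemma p_q_pow: "p ((q ^^ Suc n) v) = (q ^^ n) (X v + scale (of_nat n) (z v))"
proof (induction n)
  case (Suc n)
  have "p ((q ^^ Suc (Suc n)) v) = q (p ((q ^^ Suc n) v)) + z ((q ^^ Suc n) v)"
    by (simp add: p_q)
  moreover have "z ((q ^^ m) v) = (q ^^ m) (z v)" for m
    by (intro funpow_commute z_comm)
  ultimately show ?case by (simp only: Suc) (simp add: pow_lin lin algebra_simps)
qed (simp add: X_def)

text \<open>The analogue for \<open>e\<close>, which consumes two factors \<open>q\<close>. The
  recursion gives \<open>t = n(n+1)/2\<close>, but only the shape of the right-hand side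
  matters.\<close>

lemma e_q_pow: "\<exists>t. e ((q ^^ Suc (Suc n)) v)
  = (q ^^ n) (Y v + scale (of_nat n) (X v) + scale t (z v))"
proof (induction n)
  case 0
  show ?case by (rule exI[of _ 0]) (simp add: Y_def)
next
  case (Suc n)
  then obtain t where t: "e ((q ^^ Suc (Suc n)) v)
    = (q ^^ n) (Y v + scale (of_nat n) (X v) + scale t (z v))" ..
  have "e ((q ^^ Suc (Suc (Suc n))) v) = q (e ((q ^^ Suc (Suc n)) v)) + p ((q ^^ Suc (Suc n)) v)"
    by (simp add: e_q)
  also have "\<dots> = (q ^^ Suc n) (Y v + scale (of_nat (Suc n)) (X v)
    + scale (t + of_nat (Suc n)) (z v))"
    by (simp only: t p_q_pow) (simp add: pow_lin lin algebra_simps)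
  finally show ?case by blast
qed

text \<open>By the commutation relations, the vectors \<open>e^i p^j q^m s\<close> with \<open>s \<in> S\<close> span a submodule,
  and such a vector of weight \<open>\<nu>\<close> lies in \<open>S\<close> because the operators of weight zero are
  generated by \<open>X\<close>, \<open>Y\<close> and \<open>z\<close>.\<close>

lemma wt_irreducible:
  assumes S: "subspace S" "S \<subseteq> wt \<nu>"
    and zS: "\<And>s. s \<in> S \<Longrightarrow> z s \<in> S"
    and XS: "\<And>s. s \<in> S \<Longrightarrow> X s \<in> S"
    and YS: "\<And>s. s \<in> S \<Longrightarrow> Y s \<in> S"
  shows "S = {0} \<or> S = wt \<nu>"
proof -
  define m where "m i j n s = (e ^^ i) ((p ^^ j) ((q ^^ n) s))" for i j n s
  define W where "W = span {m i j n s | i j n s. s \<in> S}"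
  have base: "m i j n s \<in> W" if "s \<in> S" for i j n s
    using that unfolding W_def by (intro span_base) blast
  have subW: "subspace W" by (simp add: W_def)
  have stable: "A w \<in> W"
    if "endo A" "w \<in> W" "\<And>i j n s. s \<in> S \<Longrightarrow> A (m i j n s) \<in> W" for A w
  proof -
    have "W \<subseteq> {w. A w \<in> W}"
      unfolding W_def
    proof (rule span_minimal)
      show "{m i j n s |i j n s. s \<in> S} \<subseteq> {w. A w \<in> span {m i j n s |i j n s. s \<in> S}}"
        using that(3) unfolding W_def by blast
      show "subspace {w. A w \<in> span {m i j n s |i j n s. s \<in> S}}"
        by (auto simp: subspace_def endoD[OF that(1)] span_zero span_add span_scale)
    qed
    with that(2) show ?thesis by blast
  qed
  have wt_m: "m i j n s \<in> wt (\<nu> + of_nat (2 * i + j) - of_nat n)" if "s \<in> S" for i j n s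
  proof -
    have "s \<in> wt \<nu>" using S that by blast
    from wt_pow(1)[OF wt_pow(2)[OF wt_pow(3)[OF this]]] show ?thesis
      by (simp add: m_def algebra_simps)
  qed
  have "e w \<in> W \<and> h w \<in> W \<and> p w \<in> W \<and> q w \<in> W \<and> z w \<in> W" if w: "w \<in> W" for w
  proof (intro conjI)
    show "e w \<in> W"
    proof (rule stable[OF endos(1) w])
      fix i j n s assume s: "s \<in> S"
      have "e (m i j n s) = m (Suc i) j n s" by (simp add: m_def)
      then show "e (m i j n s) \<in> W" using base[OF s] by simp
    qed
    show "h w \<in> W"
    proof (rule stable[OF endos(2) w])
      fix i j n s assume s: "s \<in> S"
      have "h (m i j n s) = scale (\<nu> + of_nat (2 * i + j) - of_nat n) (m i j n s)"
        using wt_m[OF s] by (simp add: eigenspace_def)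
      then show "h (m i j n s) \<in> W" using subspace_scale[OF subW base[OF s]] by simp
    qed
    show "p w \<in> W"
    proof (rule stable[OF endos(3) w])
      fix i j n s assume s: "s \<in> S"
      have "p ((e ^^ i) u) = (e ^^ i) (p u)" for u
        by (intro funpow_commute e_p[symmetric])
      then have "p (m i j n s) = m i (Suc j) n s" by (simp add: m_def)
      then show "p (m i j n s) \<in> W" using base[OF s] by simp
    qed
    show "z w \<in> W"
    proof (rule stable[OF endos(5) w])
      fix i j n s assume s: "s \<in> S"
      have "z ((e ^^ i) u) = (e ^^ i) (z u)" "z ((p ^^ j) u) = (p ^^ j) (z u)"
        "z ((q ^^ n) u) = (q ^^ n) (z u)" for u
        by (intro funpow_commute z_comm)+
      then have "z (m i j n s) = m i j n (z s)" by (simp add: m_def)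
      then show "z (m i j n s) \<in> W" using base[OF zS[OF s]] by simp
    qed
    show "q w \<in> W"
    proof (rule stable[OF endos(4) w])
      fix i j n s assume s: "s \<in> S"
      have "z ((q ^^ n) u) = (q ^^ n) (z u)" for u
        by (intro funpow_commute z_comm)
      \<comment> \<open>Moving \<open>q\<close> to the right through \<open>e^i\<close> and
        \<open>p^j\<close> leaves correction terms that are again multiples of spanning
        vectors.\<close>
      then have "q (m i j n s) = m i j (Suc n) s - scale (of_nat j) (m i (j - 1) n (z s))
        - scale (of_nat i) (m (i - 1) (Suc j) n s)"
        by (simp add: m_def q_e_pow q_p_pow pow_lin endoD(5)[OF endo_pow[OF endos(1)]])
      then show "q (m i j n s) \<in> W"
        using base s zS by (simp add: subspace_diff subspace_scale subW)
    qed
  qed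
  then have W: "W = {0} \<or> W = UNIV" by (rule irreducible[OF subW])
  have "S \<subseteq> W" using base[of _ 0 0 0] by (auto simp: m_def)
  \<comment> \<open>Each \<open>p\<close>, taken from the right, consumes one \<open>q\<close> and
    replaces \<open>s\<close> by another element of \<open>S\<close>; \<open>red_e\<close> does the
    same with \<open>e\<close> and two factors \<open>q\<close>.\<close>
  have red_p: "\<exists>s'\<in>S. (p ^^ j) ((q ^^ (n + j)) s) = (q ^^ n) s'" if "s \<in> S" for j n s
    using that
  proof (induction j arbitrary: s)
    case (Suc j)
    have "(p ^^ Suc j) ((q ^^ (n + Suc j)) s) = (p ^^ j) (p ((q ^^ Suc (n + j)) s))"
      by (simp add: funpow_swap1)
    then have "(p ^^ Suc j) ((q ^^ (n + Suc j)) s)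
      = (p ^^ j) ((q ^^ (n + j)) (X s + scale (of_nat (n + j)) (z s)))"
      by (simp only: p_q_pow)
    moreover have "X s + scale (of_nat (n + j)) (z s) \<in> S"
      using Suc.prems S XS zS by (simp add: subspace_add subspace_scale)
    ultimately show ?case using Suc.IH by metis
  qed auto
  have red_e: "(e ^^ i) ((q ^^ (2 * i)) s) \<in> S" if "s \<in> S" for i s
    using that
  proof (induction i arbitrary: s)
    case (Suc i)
    obtain t where t: "e ((q ^^ Suc (Suc (2 * i))) s)
        = (q ^^ (2 * i)) (Y s + scale (of_nat (2 * i)) (X s) + scale t (z s))"
      using e_q_pow by blast
    have "(e ^^ Suc i) ((q ^^ (2 * Suc i)) s) = (e ^^ i) (e ((q ^^ Suc (Suc (2 * i))) s))"
      by (simp add: funpow_swap1)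
    moreover have "Y s + scale (of_nat (2 * i)) (X s) + scale t (z s) \<in> S"
      using Suc.prems S XS YS zS by (simp add: subspace_add subspace_scale)
    ultimately show ?case using Suc.IH t by metis
  qed simp
  have weight_nu: "m i j n s \<in> S" if s: "s \<in> S" and "n = 2 * i + j" for i j n s
  proof -
    obtain s' where "s' \<in> S" "(p ^^ j) ((q ^^ (2 * i + j)) s) = (q ^^ (2 * i)) s'"
      using red_p[OF s] by blast
    with red_e that show ?thesis by (simp add: m_def)
  qed
  \<comment> \<open>Each spanning vector lies in \<open>S\<close> or has a weight other than
    \<open>\<nu>\<close>. So a vector of \<open>W\<close> of weight \<open>\<nu>\<close> differs
    from an element of \<open>S\<close> by a vector of weight \<open>\<nu>\<close> in
    \<open>?O\<close>, which is zero.\<close>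
  let ?O = "span (\<Union>\<kappa>\<in>- {\<nu>}. wt \<kappa>)"
  have dec: "W \<subseteq> {s + u | s u. s \<in> S \<and> u \<in> ?O}"
    unfolding W_def
  proof (rule span_minimal)
    show "subspace {s + u | s u. s \<in> S \<and> u \<in> ?O}"
      by (rule subspace_sums[OF S(1) subspace_span])
    show "{m i j n s |i j n s. s \<in> S} \<subseteq> {s + u | s u. s \<in> S \<and> u \<in> ?O}"
    proof clarify
      fix i j n s assume s: "s \<in> S"
      show "\<exists>s' u. m i j n s = s' + u \<and> s' \<in> S \<and> u \<in> ?O"
      proof (cases "n = 2 * i + j")
        case True
        with weight_nu[OF s] span_zero show ?thesis by (metis add.right_neutral)
      next
        case False
        then have "(of_nat (2 * i + j) :: complex) \<noteq> of_nat n"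
          unfolding of_nat_eq_iff by simp
        then have "\<nu> + of_nat (2 * i + j) - of_nat n \<noteq> \<nu>"
          by (simp add: algebra_simps del: of_nat_add of_nat_mult)
        then have "m i j n s \<in> ?O" using wt_m[OF s] by (intro span_base) blast
        then show ?thesis using subspace_0[OF S(1)] by (metis add.left_neutral)
      qed
    qed
  qed
  have inW: "x \<in> S" if x: "x \<in> wt \<nu>" "x \<in> W" for x
  proof -
    obtain s u where su: "x = s + u" "s \<in> S" "u \<in> ?O" using dec x(2) by blast
    then have "u \<in> wt \<nu>"
      using subspace_diff[OF subspace_wt x(1), of s] S(2) by auto
    then have "u = 0" using eigenspace_inter_span_others[OF endos(2)] su(3) by blast
    with su show ?thesis by simp
  qed
  show ?thesis
  proof (cases "W = {0}")
    case True
    with \<open>S \<subseteq> W\<close> subspace_0[OF S(1)] show ?thesis by blast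
  next
    case False
    with W inW S(2) show ?thesis by blast
  qed
qed

section \<open>Finite-dimensional weight spaces are lines\<close>

lemma endo_XY: "endo X" "endo Y"
  by (auto intro!: endoI simp: X_def Y_def lin)

lemmas XY_lin = endo_XY[THEN endoD(1)] endo_XY[THEN endoD(2)] endo_XY[THEN endoD(3)]
  endo_XY[THEN endoD(4)] endo_XY[THEN endoD(5)]

lemma z_XY: "z (X v) = X (z v)" "z (Y v) = Y (z v)"
  by (simp_all add: X_def Y_def z_comm)

lemma subspace_wt_kernel:
  assumes "endo A"
  shows "subspace {v \<in> wt \<nu>. A v = 0}"
  using subspace_wt[of \<nu>] by (auto simp: subspace_def endoD[OF assms])

text \<open>If stability under \<open>A\<close> alone implies stability under \<open>z\<close>,
  \<open>X\<close> and \<open>Y\<close>, the weight space is irreducible for the single operator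
  \<open>A\<close>, hence at most a line.\<close>

lemma wt_line:
  assumes A: "endo A" "\<And>v. v \<in> wt \<nu> \<Longrightarrow> A v \<in> wt \<nu>"
    and "\<And>S s. subspace S \<Longrightarrow> S \<subseteq> wt \<nu> \<Longrightarrow> (\<And>s. s \<in> S \<Longrightarrow> A s \<in> S) \<Longrightarrow> s \<in> S \<Longrightarrow>
      z s \<in> S \<and> X s \<in> S \<and> Y s \<in> S"
  shows "\<exists>v. wt \<nu> \<subseteq> span {v}"
proof (rule invariant_irreducible_imp_line[OF A(1) subspace_wt A(2)])
  fix S assume "subspace S" "S \<subseteq> wt \<nu>" "\<And>s. s \<in> S \<Longrightarrow> A s \<in> S"
  with assms(3) show "S = {0} \<or> S = wt \<nu>" by (intro wt_irreducible) blast+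
qed

text \<open>Schur's lemma: the eigenspaces of the central \<open>z\<close> are submodules, and the
  finite-dimensional weight space supplies an eigenvector.\<close>

lemma z_scalar:
  assumes "fin_dim (wt \<nu>)" "wt \<nu> \<noteq> {0}"
  shows "\<exists>c. \<forall>v. z v = scale c v"
proof -
  obtain u c where u: "u \<noteq> 0" "z u = scale c u"
    using fin_dim_eigenvector[OF endos(5) subspace_wt assms wt_shift(4)] .
  have "eigenspace scale z c = {0} \<or> eigenspace scale z c = UNIV"
    by (rule irreducible[OF subspace_eigenspace[OF endos(5)]])
      (auto simp: eigenspace_def z_comm lin)
  with u have "eigenspace scale z c = UNIV" by (auto simp: eigenspace_def)
  then show ?thesis by (auto simp: eigenspace_def)
qed

lemma comm_Y_X_z0:
  assumes "\<And>v. z v = 0"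
  shows "Y (X v) = X (Y v) + X (X v)"
  by (simp add: X_def Y_def e_q e_p p_q lin assms)

text \<open>Where \<open>z\<close> acts by \<open>c \<noteq> 0\<close>, the element \<open>e - p^2 / (2c)\<close> commutes with \<open>p\<close> and \<open>q\<close>;
  \<open>w\<close> is the operator of weight zero \<open>2c (e - p^2 / (2c)) q^2\<close>.\<close>

definition w :: "'v \<Rightarrow> 'v" where "w v = z (Y v) + z (Y v) - X (X v) - X (z v)"

text \<open>Since \<open>p^2 q^2 = X^2 + X z\<close>, this is \<open>(2 z e - p^2) q^2\<close>. The
  definition in terms of \<open>X\<close>, \<open>Y\<close>, \<open>z\<close> shows instead that
  \<open>w\<close> preserves every subspace stable under these three.\<close>

lemma w_eq: "w v = z (Y v) + z (Y v) - p (p (q (q v)))"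
  by (simp add: w_def X_def p_q lin z_comm)

lemma endo_w: "endo w"
  by (rule endoI) (auto simp: w_def XY_lin lin algebra_simps)

text \<open>The factor \<open>2 z e - p^2\<close> commutes with \<open>p\<close> and
  \<open>q\<close>, while \<open>[pq, q^2] = 2 z q^2\<close>. The operator
  \<open>qp = pq - z\<close> has the same commutator with \<open>w\<close>.\<close>

lemma comm_X_w: "X (w v) = w (X v) + z (w v) + z (w v)"
  by (simp add: w_eq X_def Y_def e_q e_p p_q lin z_comm algebra_simps)

lemma comm_qp_w: "q (p (w v)) = w (q (p v)) + z (w v) + z (w v)"
  by (simp add: w_eq X_def Y_def e_q e_p p_q lin z_comm algebra_simps)

lemma z_w: "z (w v) = w (z v)"
  by (simp add: w_def z_XY lin XY_lin)

lemma wt_w: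
  assumes "v \<in> wt \<nu>"
  shows "w v \<in> wt \<nu>"
  using assms by (simp add: w_def subspace_diff subspace_add subspace_wt wt_XY wt_shift(4))

lemma Y_eq_w:
  assumes "\<And>v. z v = scale c v" "c \<noteq> 0"
  shows "Y v = scale (inverse (2 * c)) (w v + X (X v) + scale c (X v))"
proof -
  have "w v + X (X v) + scale c (X v) = scale (2 * c) (Y v)"
    using scale_left_distrib[of c c "Y v"] by (simp add: w_def assms(1) XY_lin)
  with assms(2) show ?thesis by simp
qed

lemma fin_dim_wt_line:
  assumes fd: "fin_dim (wt \<nu>)"
  shows "\<exists>v. wt \<nu> \<subseteq> span {v}"
proof (cases "wt \<nu> = {0}")
  case True
  then show ?thesis by (simp add: span_zero)
next
  case nz: False
  obtain c where c: "\<And>v. z v = scale c v" using z_scalar[OF fd nz] by auto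
  show ?thesis
  proof (cases "c = 0")
    case True
    with c have z0: "z v = 0" for v by simp
    let ?K = "{v \<in> wt \<nu>. X v = 0}"
    have "?K = {0} \<or> ?K = wt \<nu>"
    proof (rule wt_irreducible[OF subspace_wt_kernel[OF endo_XY(1)]])
      show "Y s \<in> ?K" if "s \<in> ?K" for s
        using that comm_Y_X_z0[OF z0, of s] by (simp add: wt_XY endo_XY[THEN endoD(3)])
    qed (auto simp: z0 wt_XY endo_XY[THEN endoD(3)] subspace_0[OF subspace_wt])
    moreover have "?K \<noteq> {0}"
    proof
      assume "?K = {0}"
      then have inj: "\<And>v. v \<in> wt \<nu> \<Longrightarrow> X v = 0 \<Longrightarrow> v = 0" by blast
      show False
        \<comment> \<open>The relation \<open>[Y, X] = X^2\<close> has the required form with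
          \<open>M = X\<close>.\<close>
        by (rule commutator_not_injective[where A = X and D = Y and M = X and U = "wt \<nu>"])
          (simp_all add: endo_XY fd nz subspace_wt wt_XY inj comm_Y_X_z0[OF z0])
    qed
    ultimately have X0: "X v = 0" if "v \<in> wt \<nu>" for v using that by blast
    \<comment> \<open>With \<open>z\<close> and \<open>X\<close> zero on the weight space,
      \<open>Y\<close> is the only operator left.\<close>
    show ?thesis
    proof (rule wt_line[OF endo_XY(2) wt_XY(2)])
      fix S s assume S: "subspace S" "S \<subseteq> wt \<nu>" "\<And>s. s \<in> S \<Longrightarrow> Y s \<in> S" "s \<in> S"
      then have "X s = 0" using X0 by blast
      with S show "z s \<in> S \<and> X s \<in> S \<and> Y s \<in> S" by (simp add: z0 subspace_0)
    qed
  next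
    case c0: False
    let ?K = "{v \<in> wt \<nu>. w v = 0}"
    have subK: "subspace ?K" by (rule subspace_wt_kernel[OF endo_w])
    have XK: "X s \<in> ?K" if s: "s \<in> ?K" for s
    proof -
      have "w (X s) = X (w s) - z (w s) - z (w s)" by (simp add: comm_X_w)
      also have "\<dots> = 0" using s by (simp add: endos(5)[THEN endoD(3)] endo_XY[THEN endoD(3)])
      finally show ?thesis using s by (simp add: wt_XY)
    qed
    have YS: "Y s \<in> S" if "subspace S" "\<And>s. s \<in> S \<Longrightarrow> X s \<in> S" "s \<in> S" "w s = 0" for S s
      using that by (subst Y_eq_w[OF c c0]) (simp add: subspace_scale subspace_add)
    have "?K = {0} \<or> ?K = wt \<nu>"
    proof (rule wt_irreducible[OF subK])
      show "Y s \<in> ?K" if "s \<in> ?K" for s using YS[OF subK XK that] that by simp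
      show "z s \<in> ?K" if "s \<in> ?K" for s
        using that by (simp add: c endoD[OF endo_w] subspace_scale subspace_wt)
    qed (use XK in auto)
    moreover have "?K \<noteq> {0}"
    proof
      assume "?K = {0}"
      then have inj: "\<And>v. v \<in> wt \<nu> \<Longrightarrow> w v = 0 \<Longrightarrow> v = 0" by blast
      have M: "endo (\<lambda>v. z v + z v)" by (rule endoI) (auto simp: lin algebra_simps)
      show False
      \<comment> \<open>Here \<open>M\<close> is multiplication by \<open>2 c\<close>, injective
        because \<open>c\<close> is nonzero.\<close>
      proof (rule commutator_not_injective[where A = w and D = X and M = "\<lambda>v. z v + z v"
            and U = "wt \<nu>"])
        show "z u + z u \<in> wt \<nu>" if "u \<in> wt \<nu>" for u
          using that by (simp add: subspace_add subspace_wt wt_shift)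
        show "w (z u + z u) = z (w u) + z (w u)" for u by (simp add: endoD[OF endo_w] z_w)
        show "X (w u) = w (X u) + w (z u + z u)" for u
          by (simp add: comm_X_w endoD[OF endo_w] z_w add.assoc)
        show "u = 0" if "z u + z u = 0" for u
        proof -
          have "scale (c + c) u = 0" using that by (simp only: c scale_left_distrib)
          with c0 show "u = 0" by simp
        qed
      qed (simp_all add: endo_w endo_XY M fd nz subspace_wt wt_w wt_XY inj)
    qed
    ultimately have w0: "w v = 0" if "v \<in> wt \<nu>" for v using that by blast
    \<comment> \<open>Now \<open>w\<close> vanishes and \<open>z\<close> is a scalar, so
      \<open>Y\<close> acts as a polynomial in \<open>X\<close>, and \<open>X\<close> is the only
      operator left.\<close>
    show ?thesis
    proof (rule wt_line[OF endo_XY(1) wt_XY(1)])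
      fix S s assume S: "subspace S" "S \<subseteq> wt \<nu>" "\<And>s. s \<in> S \<Longrightarrow> X s \<in> S" "s \<in> S"
      then have "w s = 0" using w0 by blast
      with S YS[OF S(1,3,4)] show "z s \<in> S \<and> X s \<in> S \<and> Y s \<in> S"
        by (simp add: c subspace_scale)
    qed
  qed
qed

section \<open>Spreading finite dimension to neighbouring weights\<close>

lemma z_generated_line:
  assumes "\<And>v. v \<in> wt \<nu> \<Longrightarrow> X v = z v \<or> X v = 0" "\<And>v. v \<in> wt \<nu> \<Longrightarrow> Y v = z v \<or> Y v = 0"
  shows "\<exists>v. wt \<nu> \<subseteq> span {v}"
\<comment> \<open>Every subspace stable under \<open>z\<close> is stable under \<open>X\<close> and
  \<open>Y\<close>. The operator \<open>z\<close> itself serves as the single generator, since it is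
  not yet known to be a scalar.\<close>
proof (rule wt_line[OF endos(5) wt_shift(4)])
  fix S s assume "subspace S" "S \<subseteq> wt \<nu>" "\<And>s. s \<in> S \<Longrightarrow> z s \<in> S" "s \<in> S"
  then show "z s \<in> S \<and> X s \<in> S \<and> Y s \<in> S"
    using assms[of s] by (metis subspace_0 subsetD)
qed

lemma line_fin_dim: "\<exists>v. U \<subseteq> span {v} \<Longrightarrow> fin_dim U"
  unfolding fin_dim_def by (metis finite.emptyI finite.insertI)

text \<open>The kernel of \<open>q\<close> in weight \<open>\<nu> + 1\<close> is stable, since
  \<open>X\<close> and \<open>Y\<close> apply \<open>q\<close> first. If it is zero,
  \<open>q\<close> embeds the space into weight \<open>\<nu>\<close>; otherwise \<open>X\<close> and
  \<open>Y\<close> vanish there and only \<open>z\<close> acts.\<close>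

lemma fin_dim_wt_up:
  assumes fd: "fin_dim (wt \<nu>)"
  shows "fin_dim (wt (\<nu> + 1))"
proof -
  let ?K = "{v \<in> wt (\<nu> + 1). q v = 0}"
  have "?K = {0} \<or> ?K = wt (\<nu> + 1)"
    by (rule wt_irreducible[OF subspace_wt_kernel[OF endos(4)]])
      (auto simp: X_def Y_def lin wt_shift subspace_0[OF subspace_wt] simp flip: z_comm)
  then show ?thesis
  proof
    assume K: "?K = {0}"
    show ?thesis
    proof (rule fin_dim_inj[OF endos(4) subspace_wt _ _ fd])
      show "q ` wt (\<nu> + 1) \<subseteq> wt \<nu>" using wt_shift(3)[of _ "\<nu> + 1"] by auto
    qed (use K in blast)
  next
    assume "?K = wt (\<nu> + 1)"
    then have "q v = 0" if "v \<in> wt (\<nu> + 1)" for v using that by blast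
    then show ?thesis
      by (intro line_fin_dim z_generated_line) (auto simp: X_def Y_def lin)
  qed
qed

text \<open>The kernel of the central \<open>z\<close> is a submodule.\<close>

lemma z_zero_or_injective: "(\<forall>v. z v = 0) \<or> (\<forall>v. z v = 0 \<longrightarrow> v = 0)"
proof -
  have "{v. z v = 0} = {0} \<or> {v. z v = 0} = UNIV"
    by (rule irreducible[OF subspace_kernel[OF endos(5)]]) (auto simp: lin z_comm)
  then show ?thesis by blast
qed

text \<open>From \<open>pq = qp + z\<close> it follows that \<open>X = z\<close>, and
  \<open>[qp, w] = 2 z w\<close> gives \<open>w = 0\<close>. The definition of \<open>w\<close> then
  reads \<open>2 z Y = 2 z^2\<close>, and cancelling \<open>z\<close> leaves
  \<open>Y = z\<close>.\<close>

lemma qp_zero_line: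
  assumes inj: "\<And>v. z v = 0 \<Longrightarrow> v = 0"
    and qp: "\<And>v. v \<in> wt \<nu> \<Longrightarrow> q (p v) = 0"
  shows "\<exists>v. wt \<nu> \<subseteq> span {v}"
proof -
  have X: "X v = z v" if "v \<in> wt \<nu>" for v using qp[OF that] by (simp add: X_def p_q)
  have "Y v = z v" if v: "v \<in> wt \<nu>" for v
  proof -
    have "z (w v + w v) = 0"
      using comm_qp_w[of v] qp[OF v] qp[OF wt_w[OF v]]
      by (simp add: lin endoD[OF endo_w])
    from inj[OF this] have "w v = 0" using double_cancel[of "w v" 0] by simp
    then have "z (Y v) + z (Y v) = z (z v) + z (z v)"
      using v by (simp add: w_def X wt_shift(4) diff_diff_add)
    from double_cancel[OF this] have "z (Y v - z v) = 0" by (simp add: lin)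
    from inj[OF this] show "Y v = z v" by simp
  qed
  with X show ?thesis by (intro z_generated_line) simp_all
qed

lemma fin_dim_wt_down:
  assumes fd: "fin_dim (wt \<nu>)"
  shows "fin_dim (wt (\<nu> - 1))"
proof -
  let ?U = "wt (\<nu> - 1)"
  have pU: "p v \<in> wt \<nu>" if "v \<in> ?U" for v using wt_shift(2)[OF that] by simp
  have qU: "q v \<in> ?U" if "v \<in> wt \<nu>" for v using wt_shift(3)[OF that] .
  \<comment> \<open>If the weight space \<open>wt \<nu>\<close> is zero, it supplies no eigenvector
    of \<open>z\<close>, so only injectivity of \<open>z\<close> is available; that case is kept
    apart.\<close>
  consider (zero) "\<And>v. z v = 0" | (trivial) "\<And>v. z v = 0 \<Longrightarrow> v = 0" "wt \<nu> = {0}"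
    | (scalar) c where "\<And>v. z v = scale c v" "c \<noteq> 0"
  proof (cases "\<forall>v. z v = 0")
    case False
    then have inj: "\<And>v. z v = 0 \<Longrightarrow> v = 0" using z_zero_or_injective by blast
    show ?thesis
    proof (cases "wt \<nu> = {0}")
      case True
      with inj trivial show ?thesis by blast
    next
      case False
      obtain c where "\<And>v. z v = scale c v" using z_scalar[OF fd False] by auto
      with \<open>\<not> (\<forall>v. z v = 0)\<close> scalar show ?thesis by (cases "c = 0") auto
    qed
  qed blast
  then show ?thesis
  proof cases
    case zero
    \<comment> \<open>With \<open>z = 0\<close>, \<open>p\<close> commutes with \<open>e\<close> and
      \<open>q\<close>, so its kernel is stable under \<open>X\<close> and \<open>Y\<close>.\<close>
    let ?K = "{v \<in> ?U. p v = 0}"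
    have "?K = {0} \<or> ?K = ?U"
      by (rule wt_irreducible[OF subspace_wt_kernel[OF endos(3)]])
        (auto simp: zero wt_XY subspace_0[OF subspace_wt],
          auto simp: X_def Y_def zero p_q lin simp flip: e_p)
    then show ?thesis
    proof
      assume K: "?K = {0}"
      show ?thesis
        by (rule fin_dim_inj[OF endos(3) subspace_wt _ _ fd]) (use K pU in blast)+
    next
      assume "?K = ?U"
      then have "p v = 0" if "v \<in> ?U" for v using that by blast
      then have X0: "X v = 0" if "v \<in> ?U" for v using that by (simp add: X_def p_q zero lin)
      show ?thesis
        by (rule line_fin_dim, rule wt_line[OF endo_XY(2) wt_XY(2)])
          (auto simp: zero X0 subspace_0 subset_iff)
    qed
  next
    case trivial
    then have p0: "p v = 0" if "v \<in> ?U" for v using pU[OF that] by blast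
    show ?thesis
      by (rule line_fin_dim, rule qp_zero_line[OF trivial(1)]) (auto simp: p0 lin)
  next
    case scalar
    \<comment> \<open>This subspace is finite-dimensional as a sum of two images of
      \<open>wt \<nu>\<close>. It contains \<open>qp\<close> of all of \<open>?U\<close>, because
      \<open>p\<close> maps \<open>?U\<close> into \<open>wt \<nu>\<close>; then
      \<open>2 c w = [qp, w]\<close> puts \<open>w\<close> of all of \<open>?U\<close> into it as
      well. Stability under \<open>X = qp + c\<close> and \<open>Y\<close> follows.\<close>
    define S where "S = {x + y | x y. x \<in> q ` wt \<nu> \<and> y \<in> (\<lambda>u. w (q u)) ` wt \<nu>}"
    have qw: "endo (\<lambda>u. w (q u))" by (rule endoI) (auto simp: endoD[OF endo_w] lin)
    have subS: "subspace S"
      unfolding S_def by (intro subspace_sums endo_image_subspace subspace_wt endos qw)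
    have fdS: "fin_dim S"
      unfolding S_def by (intro fin_dim_sums fin_dim_image fd endos qw)
    have SU: "S \<subseteq> ?U"
      using qU wt_w by (auto simp: S_def intro!: subspace_add[OF subspace_wt])
    have qS: "q u \<in> S" and wqS: "w (q u) \<in> S" if "u \<in> wt \<nu>" for u
    proof -
      have "0 \<in> wt \<nu>" by (rule subspace_0[OF subspace_wt])
      then have "q u + w (q 0) \<in> S" "q 0 + w (q u) \<in> S"
        using that unfolding S_def by blast+
      then show "q u \<in> S" "w (q u) \<in> S" by (simp_all add: lin endoD[OF endo_w])
    qed
    have qpS: "q (p v) \<in> S" if "v \<in> ?U" for v by (intro qS pU that)
    have wS: "w v \<in> S" if v: "v \<in> ?U" for v
    proof -
      have "scale (2 * c) (w v) = q (p (w v)) - w (q (p v))"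
        using scale_left_distrib[of c c "w v"] by (simp add: comm_qp_w scalar(1))
      moreover have "\<dots> \<in> S"
        by (intro subspace_diff[OF subS] qpS wqS pU wt_w v)
      ultimately have "scale (inverse (2 * c)) (scale (2 * c) (w v)) \<in> S"
        using subspace_scale[OF subS] by simp
      with scalar(2) show ?thesis by simp
    qed
    have XS: "X s \<in> S" if "s \<in> S" for s
      using that SU qpS by (auto simp: X_def p_q scalar(1) intro!: subspace_add[OF subS]
          subspace_scale[OF subS])
    have "S = {0} \<or> S = ?U"
    proof (rule wt_irreducible[OF subS SU])
      show "z s \<in> S" if "s \<in> S" for s using that by (simp add: scalar(1) subspace_scale subS)
      show "Y s \<in> S" if "s \<in> S" for s
        unfolding Y_eq_w[OF scalar]
        by (intro subspace_scale[OF subS] subspace_add[OF subS] wS XS that subsetD[OF SU])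
    qed (rule XS)
    then show ?thesis
    proof
      assume "S = {0}"
      with qpS have "q (p v) = 0" if "v \<in> ?U" for v using that by blast
      then show ?thesis
        by (intro line_fin_dim qp_zero_line) (auto simp: scalar)
    qed (use fdS in simp)
  qed
qed

lemma fin_dim_all_weights:
  assumes "fin_dim (wt (\<mu> + of_int i))"
  shows "fin_dim (wt (\<mu> + of_int j))"
proof (induction j rule: int_induct[of _ i])
  case base
  show ?case by fact
next
  case (step1 j)
  from fin_dim_wt_up[OF step1(2)] show ?case by (simp add: algebra_simps)
next
  case (step2 j)
  from fin_dim_wt_down[OF step2(2)] show ?case by (simp add: algebra_simps)
qed

lemma weight_multiplicities:
  "(\<forall>i::int. edim scale (wt (\<mu> + of_int i)) \<le> 1) \<or>
   (\<forall>i::int. edim scale (wt (\<mu> + of_int i)) = \<infinity>)"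
proof (cases "\<exists>i::int. fin_dim (wt (\<mu> + of_int i))")
  case True
  have "edim scale (wt (\<mu> + of_int i)) \<le> 1" for i :: int
  proof -
    have fd: "fin_dim (wt (\<mu> + of_int i))" using True fin_dim_all_weights by blast
    then obtain v where "wt (\<mu> + of_int i) \<subseteq> span {v}" using fin_dim_wt_line by blast
    from dim_le_card[OF this] have "dim (wt (\<mu> + of_int i)) \<le> 1" by simp
    with fd show ?thesis by (simp add: edim_def fin_dim_def one_enat_def)
  qed
  then show ?thesis by blast
next
  case False
  then show ?thesis by (auto simp: edim_def fin_dim_def)
qed

end

section \<open>From the Lie module to its five operators\<close>

theorem corollary12:
  fixes scale :: "complex \<Rightarrow> 'g::ab_group_add \<Rightarrow> 'g"
    and bracket :: "'g \<Rightarrow> 'g \<Rightarrow> 'g"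
    and e h p q z :: 'g
    and scaleV :: "complex \<Rightarrow> 'v::ab_group_add \<Rightarrow> 'v"
    and act :: "'g \<Rightarrow> 'v \<Rightarrow> 'v"
    and \<mu> :: complex
  assumes "ageing_module scale bracket e h p q z scaleV act"
    and "simple_lie_module scaleV act"
    and "diagonalizable scaleV (act h)"
    and "eigenspace scaleV (act h) \<mu> \<noteq> {0}"
  shows "(\<forall>i::int. edim scaleV (eigenspace scaleV (act h) (\<mu> + of_int i)) \<le> 1) \<or>
         (\<forall>i::int. edim scaleV (eigenspace scaleV (act h) (\<mu> + of_int i)) = \<infinity>)"
proof -
  interpret ageing_module scale bracket e h p q z scaleV act by fact
  have act_add: "act (x + y) v = act x v + act y v"
    and act_scale: "act (scale c x) v = scaleV c (act x v)"
    and act_0: "act 0 v = 0" and act_minus: "act (- x) v = - act x v" for x y c v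
  proof -
    interpret a: Vector_Spaces.linear scale scaleV "\<lambda>x. act x v" by (rule act_linear_left)
    show "act (x + y) v = act x v + act y v" "act (scale c x) v = scaleV c (act x v)"
      "act 0 v = 0" "act (- x) v = - act x v"
      by (fact a.add a.scale a.zero a.neg)+
  qed
  have act_right: "act x (u + v) = act x u + act x v" "act x (scaleV c v) = scaleV c (act x v)"
    for x u v c
  proof -
    interpret a: Vector_Spaces.linear scaleV scaleV "\<lambda>v. act x v" by (rule act_linear_right)
    show "act x (u + v) = act x u + act x v" "act x (scaleV c v) = scaleV c (act x v)"
      by (fact a.add a.scale)+
  qed
  have comm: "act x (act y v) = act y (act x v) + act (bracket x y) v" for x y v
    by (simp add: act_bracket)
  interpret simple_ageing_operators scaleV "act e" "act h" "act p" "act q" "act z"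
  proof
    fix W
    assume W: "V.subspace W"
      and stable: "\<And>w. w \<in> W \<Longrightarrow>
        act e w \<in> W \<and> act h w \<in> W \<and> act p w \<in> W \<and> act q w \<in> W \<and> act z w \<in> W"
    \<comment> \<open>The action is linear in the algebra element, so stability under the five basis
      elements gives stability under the whole algebra.\<close>
    have "act x w \<in> W" if "w \<in> W" for x w
    proof -
      have "x \<in> module.span scale {e, h, p, q, z}" by (simp add: basis_span)
      then show ?thesis
      proof (induction rule: span_induct_alt)
        case base
        show ?case using V.subspace_0[OF W] by (simp add: act_0)
      next
        case (step c x y)
        then show ?case
          using stable[OF that] W by (auto simp: act_add act_scale V.subspace_add V.subspace_scale)
      qed
    qed
    with W have "lie_submodule scaleV act W" by (simp add: lie_submodule_def)
    with assms(2) show "W = {0} \<or> W = UNIV" by (simp add: simple_lie_module_def)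
  next
    fix v
    show "act e (act q v) = act q (act e v) + act p v"
      by (simp add: comm[of e q] bracket_e_q)
    show "act e (act p v) = act p (act e v)"
      by (simp add: comm[of e p] bracket_e_p act_0)
    show "act p (act q v) = act q (act p v) + act z v"
      by (simp add: comm[of p q] bracket_p_q)
    show "act h (act e v) = act e (act h v) + scaleV 2 (act e v)"
      by (simp add: comm[of h e] bracket_h_e act_scale)
    show "act h (act p v) = act p (act h v) + act p v"
      by (simp add: comm[of h p] bracket_h_p)
    show "act h (act q v) = act q (act h v) - act q v"
      by (simp add: comm[of h q] bracket_h_q act_minus)
    show "act z (act e v) = act e (act z v)" "act z (act h v) = act h (act z v)"
      "act z (act p v) = act p (act z v)" "act z (act q v) = act q (act z v)"
      by (simp_all add: comm[of z] z_central act_0)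
  qed (fact act_right)+
  show ?thesis by (rule weight_multiplicities)
qed

end
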